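(* Let $k\ge 1$ be an integer and let $A$ be the sequence defined by $A(1)=A(2)=1$ and $$A(n) = A\big(A^k(n-1)\big) + A\big(n-A^k(n-1)\big) \quad (n\ge 3),$$ where $A^k$ denotes the $k$-fold composition of $A$. Let $E_n$ be defined by $E_n=1$ for $1\le n\le k$ and $E_n=E_{n-1}+E_{n-k}$ for $n>k$. Then $A(E_n)=E_{n-1}$ for all $n\ge 2$. *)

theory Defs
  imports Main
begin

text \<open>
  The recurrences determine both sequences on the positive integers, and sequences satisfying
  them exist. Values at index 0 are junk: they are unconstrained and never enter the recurrences.
\<close>

primrec prefix_A :: "nat \<Rightarrow> nat \<Rightarrow> nat \<Rightarrow> nat" where
  "prefix_A k 0 = (\<lambda>_. 1)"
| "prefix_A k (Suc N) = (prefix_A k N)(Suc N :=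
     if N < 2 then 1
     else prefix_A k N ((prefix_A k N ^^ k) N) + prefix_A k N (Suc N - (prefix_A k N ^^ k) N))"

lemma prefix_A_stable: "m \<le> N \<Longrightarrow> prefix_A k N m = prefix_A k m m"
  by (induction N) (auto simp: le_Suc_eq)

lemma funpow_bounds:
  fixes f :: "nat \<Rightarrow> nat"
  assumes "\<And>m. 1 \<le> m \<Longrightarrow> m \<le> N \<Longrightarrow> 1 \<le> f m \<and> f m \<le> m" and "1 \<le> N"
  shows "1 \<le> (f ^^ j) N \<and> (f ^^ j) N \<le> N"
proof (induction j)
  case (Suc j)
  then show ?case using assms(1)[of "(f ^^ j) N"] by auto
qed (use assms(2) in simp)

lemma recurrence_bounds:
  fixes A :: "nat \<Rightarrow> nat"
  assumes "A 1 = 1" and "A 2 = 1"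
    and rec: "\<And>n. 3 \<le> n \<Longrightarrow> A n = A ((A ^^ k) (n - 1)) + A (n - (A ^^ k) (n - 1))"
    and "1 \<le> n"
  shows "1 \<le> A n \<and> A n \<le> n"
  using \<open>1 \<le> n\<close>
proof (induction n rule: less_induct)
  case (less n)
  show ?case
  proof (cases "n \<le> 2")
    case True
    then have "n = 1 \<or> n = 2" using less.prems by linarith
    then show ?thesis using assms(1,2) by auto
  next
    case False
    define a where "a = (A ^^ k) (n - 1)"
    have a: "1 \<le> a" "a \<le> n - 1"
      using funpow_bounds[of "n - 1" A k] less.IH False unfolding a_def by auto
    have "1 \<le> A a \<and> A a \<le> a" "1 \<le> A (n - a) \<and> A (n - a) \<le> n - a"
      using less.IH[of a] less.IH[of "n - a"] a False by auto
    moreover have "A n = A a + A (n - a)" using rec[of n] False unfolding a_def by auto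
    ultimately show ?thesis using a by linarith
  qed
qed

lemma A_exists:
  "\<exists>A :: nat \<Rightarrow> nat. A 1 = 1 \<and> A 2 = 1 \<and>
     (\<forall>n\<ge>3. A n = A ((A ^^ k) (n - 1)) + A (n - (A ^^ k) (n - 1)))"
proof -
  define A where "A = (\<lambda>n. prefix_A k n n)"
  have step: "A (Suc N) = A ((A ^^ k) N) + A (Suc N - (A ^^ k) N) \<and> A (Suc N) \<le> Suc N \<and> 1 \<le> A (Suc N)"
    if N: "2 \<le> N" and b: "\<And>m. 1 \<le> m \<Longrightarrow> m \<le> N \<Longrightarrow> 1 \<le> A m \<and> A m \<le> m" for N
  proof -
    have bb: "1 \<le> (A ^^ j) N \<and> (A ^^ j) N \<le> N" for j
      using funpow_bounds[of N A j] b N by auto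
    have eq: "prefix_A k N m = A m" if "m \<le> N" for m
      unfolding A_def using that by (rule prefix_A_stable)
    have it: "(prefix_A k N ^^ j) N = (A ^^ j) N" for j
    proof (induction j)
      case (Suc j)
      then show ?case using eq[of "(A ^^ j) N"] bb[of j] by simp
    qed simp
    define a where "a = (A ^^ k) N"
    have a: "1 \<le> a" "a \<le> N" using bb unfolding a_def by auto
    have "A (Suc N) = prefix_A k N a + prefix_A k N (Suc N - a)"
      using N unfolding A_def[THEN fun_cong, of "Suc N"] a_def it[symmetric] by simp
    then have "A (Suc N) = A a + A (Suc N - a)"
      using eq[of a] eq[of "Suc N - a"] a by linarith
    moreover have "1 \<le> A a \<and> A a \<le> a" "1 \<le> A (Suc N - a) \<and> A (Suc N - a) \<le> Suc N - a"
      using b[of a] b[of "Suc N - a"] a by auto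
    ultimately show ?thesis using a unfolding a_def by linarith
  qed
  have A12: "A 1 = 1" "A 2 = 1" unfolding A_def by (simp_all add: numeral_2_eq_2)
  have bnd: "1 \<le> n \<Longrightarrow> 1 \<le> A n \<and> A n \<le> n" for n
  proof (induction n rule: less_induct)
    case (less n)
    show ?case
    proof (cases "n \<le> 2")
      case True
      then have "n = 1 \<or> n = 2" using less.prems by linarith
      then show ?thesis using A12 by auto
    next
      case False
      then have "2 \<le> n - 1" "Suc (n - 1) = n" by auto
      moreover have "1 \<le> A m \<and> A m \<le> m" if "1 \<le> m" "m \<le> n - 1" for m
        using less.IH[of m] that False by auto
      ultimately show ?thesis using step[of "n - 1"] by metis
    qed
  qed
  have "A n = A ((A ^^ k) (n - 1)) + A (n - (A ^^ k) (n - 1))" if "3 \<le> n" for n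
  proof -
    have "2 \<le> n - 1" "Suc (n - 1) = n" using that by auto
    then show ?thesis using step[of "n - 1"] bnd by metis
  qed
  then show ?thesis using A12 by blast
qed

function seq_E :: "nat \<Rightarrow> nat \<Rightarrow> nat" where
  "seq_E k n = (if n \<le> k \<or> k = 0 then 1 else seq_E k (n - 1) + seq_E k (n - k))"
  by auto
termination by (relation "measure snd") auto

declare seq_E.simps [simp del]

lemma E_exists:
  assumes "1 \<le> k"
  shows "\<exists>E :: nat \<Rightarrow> nat. (\<forall>n. 1 \<le> n \<and> n \<le> k \<longrightarrow> E n = 1) \<and> (\<forall>n>k. E n = E (n - 1) + E (n - k))"
proof (intro exI[of _ "seq_E k"] conjI allI impI)
  show "seq_E k n = 1" if "1 \<le> n \<and> n \<le> k" for n
    using that by (simp add: seq_E.simps)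
  show "seq_E k n = seq_E k (n - 1) + seq_E k (n - k)" if "k < n" for n
    using that assms by (subst seq_E.simps) simp
qed

end

theory Submission
  imports Defs
begin

text \<open>
  Consecutive values of \<open>A\<close>, hence also of its iterates, differ by 0 or 1. The induction carries
  along that \<open>A\<close> does not increase at the last step before \<open>E m\<close>, that is
  \<open>A (E m - 1) = A (E m) = E (m - 1)\<close>, which holds from \<open>m = 2 k + 1\<close> on.

  For the step, let \<open>E m \<le> n < E (m + 1)\<close> and write \<open>b = A\<^sup>k (n - 1)\<close> and \<open>c = n - b\<close>, so that
  \<open>A n = A b + A c\<close>. As long as \<open>b \<le> E (m + 1 - k)\<close> and \<open>c \<le> E m\<close>, slow growth backwards
  from \<open>E (m + 1 - k)\<close> and \<open>E m\<close>, where the plateau saves one unit, gives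
  \<open>E m - (E (m + 1) - n) + 1 \<le> A n \<le> E m\<close>. Applying \<open>A\<^sup>k\<^sup>-\<^sup>1\<close> shows that the bounds
  on \<open>b\<close> and \<open>c\<close> persist at \<open>n + 1\<close>. At \<open>n = E (m + 1) - 1\<close> this gives \<open>A n = E m\<close>, whence
  \<open>b = E (m + 1 - k)\<close> and \<open>c = E m\<close> at \<open>n = E (m + 1)\<close>.
\<close>

section \<open>Slow growth of \<open>A\<close> and of its iterates\<close>

lemma funpow_slow_step:
  fixes f :: "nat \<Rightarrow> nat"
  assumes bnd: "\<And>m. 1 \<le> m \<Longrightarrow> m \<le> N \<Longrightarrow> 1 \<le> f m \<and> f m \<le> m"
    and slow: "\<And>m. 1 \<le> m \<Longrightarrow> m < N \<Longrightarrow> f m \<le> f (Suc m) \<and> f (Suc m) \<le> Suc (f m)"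
    and "1 \<le> m" "m < N"
  shows "(f ^^ i) m \<le> (f ^^ i) (Suc m) \<and> (f ^^ i) (Suc m) \<le> Suc ((f ^^ i) m)"
proof (induction i)
  case (Suc i)
  have "1 \<le> (f ^^ i) m" "(f ^^ i) (Suc m) \<le> N"
    using funpow_bounds[of m f i] funpow_bounds[of "Suc m" f i] bnd assms(3,4) by force+
  moreover have "(f ^^ i) (Suc m) = (f ^^ i) m \<or> (f ^^ i) (Suc m) = Suc ((f ^^ i) m)"
    using Suc.IH by linarith
  ultimately show ?case using slow[of "(f ^^ i) m"] by auto
qed simp

lemma slow_mono:
  fixes f :: "nat \<Rightarrow> nat"
  assumes slow: "\<And>m. 1 \<le> m \<Longrightarrow> f m \<le> f (Suc m) \<and> f (Suc m) \<le> Suc (f m)"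
    and "1 \<le> x" "x \<le> y"
  shows "f x \<le> f y \<and> f y \<le> f x + (y - x)"
  using \<open>x \<le> y\<close>
proof (induction y rule: dec_induct)
  case (step n)
  then show ?case using slow[of n] \<open>1 \<le> x\<close> by linarith
qed simp

locale conway_recurrence =
  fixes k :: nat and A :: "nat \<Rightarrow> nat"
  assumes k_pos: "1 \<le> k"
    and A_1: "A 1 = 1" and A_2: "A 2 = 1"
    and A_rec: "\<And>n. 3 \<le> n \<Longrightarrow> A n = A ((A ^^ k) (n - 1)) + A (n - (A ^^ k) (n - 1))"
begin

lemma A_bounds: "1 \<le> n \<Longrightarrow> 1 \<le> A n \<and> A n \<le> n"
  using recurrence_bounds A_1 A_2 A_rec by blast

lemma iter_bounds: "1 \<le> n \<Longrightarrow> 1 \<le> (A ^^ i) n \<and> (A ^^ i) n \<le> n"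
  using funpow_bounds A_bounds by blast

text \<open>On this range \<open>A\<close> lowers its argument by one until it reaches 1, so
  \<open>k\<close> iterations from \<open>j\<close> end at 1 and the recurrence reads
  \<open>A (Suc j) = 1 + A j\<close>.\<close>

lemma A_initial: "1 \<le> j \<Longrightarrow> j \<le> Suc k \<Longrightarrow> A (Suc j) = j"
proof (induction j rule: less_induct)
  case (less j)
  show ?case
  proof (cases "j = 1")
    case False
    have iter: "(A ^^ i) j = max 1 (j - i)" for i
    proof (induction i)
      case (Suc i)
      show ?case
      proof (cases "j - i \<le> 1")
        case False
        then have "A (Suc (j - Suc i)) = j - Suc i"
          using less.IH[of "j - Suc i"] less.prems by simp
        moreover have "Suc (j - Suc i) = j - i" using False by simp
        ultimately show ?thesis using Suc False by (simp add: max_def)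
      qed (use Suc A_1 in auto)
    qed (use less.prems in simp)
    have "(A ^^ k) j = 1" using iter[of k] less.prems by simp
    then have "A (Suc j) = A 1 + A j" using A_rec[of "Suc j"] less.prems False by simp
    moreover have "A (Suc (j - 1)) = j - 1" using less.IH[of "j - 1"] less.prems False by simp
    ultimately show ?thesis using less.prems A_1 by simp
  qed (use A_2 in \<open>simp add: numeral_2_eq_2\<close>)
qed

lemma iter_initial: "1 \<le> j \<Longrightarrow> j + i \<le> k + 2 \<Longrightarrow> (A ^^ i) (j + i) = j"
proof (induction i arbitrary: j)
  case (Suc i)
  then show ?case using A_initial[of j] Suc.IH[of "Suc j"] by simp
qed simp

text \<open>From \<open>n\<close> to \<open>Suc n\<close>, exactly one of the two arguments in the
  recurrence advances, and by one; the other is unchanged.\<close>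

lemma A_slow_step: "1 \<le> n \<Longrightarrow> A n \<le> A (Suc n) \<and> A (Suc n) \<le> Suc (A n)"
proof (induction n rule: less_induct)
  case (less n)
  consider "n = 1" | "n = 2" | "3 \<le> n" using less.prems by linarith
  then show ?case
  proof cases
    case 1
    then show ?thesis using A_1 A_2 by (simp add: numeral_2_eq_2)
  next
    case 2
    then show ?thesis using A_initial[of 2] A_2 k_pos by simp
  next
    case 3
    define b b' where "b = (A ^^ k) (n - 1)" and "b' = (A ^^ k) n"
    have b: "1 \<le> b" "b \<le> n - 1" using iter_bounds[of "n - 1" k] 3 unfolding b_def by auto
    \<comment> \<open>Slow growth is needed only below \<open>n\<close> here, as the induction
      hypothesis provides.\<close>
    have "b \<le> b' \<and> b' \<le> Suc b"
      using funpow_slow_step[of n A "n - 1" k] A_bounds less.IH 3 unfolding b_def b'_def by simp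
    then have "b' = b \<or> b' = Suc b" by linarith
    moreover have "A n = A b + A (n - b)" "A (Suc n) = A b' + A (Suc n - b')"
      using A_rec[of n] A_rec[of "Suc n"] 3 unfolding b_def b'_def by auto
    moreover have "A b \<le> A (Suc b) \<and> A (Suc b) \<le> Suc (A b)" using less.IH[of b] b 3 by auto
    moreover have "A (n - b) \<le> A (Suc (n - b)) \<and> A (Suc (n - b)) \<le> Suc (A (n - b))"
      using less.IH[of "n - b"] b 3 by auto
    moreover have "Suc n - b = Suc (n - b)" using b by simp
    ultimately show ?thesis by auto
  qed
qed

lemma iter_slow:
  assumes "1 \<le> x" "x \<le> y"
  shows "(A ^^ i) x \<le> (A ^^ i) y \<and> (A ^^ i) y \<le> (A ^^ i) x + (y - x)"
proof (rule slow_mono[OF _ assms])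
  show "(A ^^ i) m \<le> (A ^^ i) (Suc m) \<and> (A ^^ i) (Suc m) \<le> Suc ((A ^^ i) m)" if "1 \<le> m" for m
    using funpow_slow_step[of "Suc m" A m i] A_bounds A_slow_step that by simp
qed

lemma A_slow: "1 \<le> x \<Longrightarrow> x \<le> y \<Longrightarrow> A x \<le> A y \<and> A y \<le> A x + (y - x)"
  using iter_slow[of x y 1] by simp

end

section \<open>Values of \<open>A\<close> at the numbers \<open>E n\<close>\<close>

locale conway_pair = conway_recurrence +
  fixes E :: "nat \<Rightarrow> nat"
  assumes E_one: "\<And>n. 1 \<le> n \<Longrightarrow> n \<le> k \<Longrightarrow> E n = 1"
    and E_rec: "\<And>n. k < n \<Longrightarrow> E n = E (n - 1) + E (n - k)"
begin

lemma E_pos: "1 \<le> n \<Longrightarrow> 1 \<le> E n"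
proof (induction n rule: less_induct)
  case (less n)
  show ?case
  proof (cases "n \<le> k")
    case False
    then have "1 \<le> n - 1" "n - 1 < n" using k_pos by auto
    then show ?thesis using less.IH[of "n - 1"] E_rec[of n] False by simp
  qed (use less.prems E_one in simp)
qed

lemma E_initial: "j \<le> k \<Longrightarrow> E (k + j) = Suc j"
proof (induction j)
  case (Suc j)
  then show ?case using E_rec[of "k + Suc j"] E_one[of "Suc j"] by simp
qed (use E_one k_pos in simp)

lemma E_2k_1: "E (2 * k + 1) = k + 3"
  using E_rec[of "2 * k + 1"] E_initial[of k] E_initial[of 1] k_pos by (simp add: mult_2)

lemma A_E_initial:
  assumes "2 \<le> n" "n \<le> 2 * k"
  shows "A (E n) = E (n - 1)"
proof (cases "n \<le> k")
  case True
  then show ?thesis using E_one[of n] E_one[of "n - 1"] A_1 assms by simp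
next
  case False
  then obtain j where j: "n = k + Suc j" using less_imp_Suc_add[of k n] by auto
  then show ?thesis using E_initial[of "Suc j"] E_initial[of j] A_initial[of "Suc j"] assms by simp
qed

lemma A_E_2k_1: "A (E (2 * k + 1)) = E (2 * k)" "A (E (2 * k + 1) - 1) = E (2 * k)"
proof -
  have "(A ^^ k) (k + 2) = 2" using iter_initial[of 2 k] by (simp add: add.commute)
  then have "A (k + 3) = A 2 + A (k + 1)" using A_rec[of "k + 3"] by simp
  then show "A (E (2 * k + 1)) = E (2 * k)"
    using E_2k_1 E_initial[of k] A_initial[of k] A_2 k_pos by (simp add: mult_2)
  show "A (E (2 * k + 1) - 1) = E (2 * k)"
    using E_2k_1 E_initial[of k] A_initial[of "k + 1"] by (simp add: mult_2)
qed

lemma iter_E: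
  assumes "\<And>i. 2 \<le> i \<Longrightarrow> i \<le> m \<Longrightarrow> A (E i) = E (i - 1)" and "i < m"
  shows "(A ^^ i) (E m) = E (m - i)"
  using \<open>i < m\<close>
proof (induction i)
  case (Suc i)
  then show ?case using assms(1)[of "m - i"] by simp
qed simp

lemma A_E_step:
  assumes m: "2 * k + 1 \<le> m"
    and IH: "\<And>i. 2 \<le> i \<Longrightarrow> i \<le> m \<Longrightarrow> A (E i) = E (i - 1)"
    and plateau: "A (E m - 1) = E (m - 1)"
  shows "A (E (m + 1)) = E m \<and> A (E (m + 1) - 1) = E m"
proof -
  \<comment> \<open>\<open>F\<close> is both the increment from \<open>E m\<close> to
    \<open>E (m + 1)\<close> and the image of \<open>E m\<close> under \<open>k - 1\<close>
    iterations of \<open>A\<close>.\<close>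
  define F where "F = E (m + 1 - k)"
  have F: "1 \<le> F" "A F = E (m - k)" "(A ^^ (k - 1)) (E m) = F" "(A ^^ k) (E m) \<le> F"
  proof -
    show "1 \<le> F" unfolding F_def using E_pos m k_pos by simp
    show AF: "A F = E (m - k)" unfolding F_def using IH[of "m + 1 - k"] m k_pos by simp
    show "(A ^^ (k - 1)) (E m) = F"
      unfolding F_def using iter_E[OF IH, of m "k - 1"] m k_pos by simp
    show "(A ^^ k) (E m) \<le> F"
      using iter_E[OF IH, of m k] m k_pos AF A_bounds[OF \<open>1 \<le> F\<close>] by simp
  qed
  have E_Suc: "E (m + 1) = E m + F" unfolding F_def using E_rec[of "m + 1"] m by simp
  have E_m: "E m = E (m - 1) + E (m - k)" using E_rec[of m] m by simp
  have "3 \<le> E m"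
  proof -
    have "E (2 * k + 1) \<le> E m"
      using m
    proof (induction m rule: dec_induct)
      case (step n)
      then show ?case using E_rec[of "Suc n"] by simp
    qed simp
    then show ?thesis using E_2k_1 by simp
  qed
  have iter_Suc: "(A ^^ k) n = (A ^^ (k - 1)) (A n)" for n
    using k_pos funpow_Suc_right[of "k - 1" A] by simp
  define b where "b n = (A ^^ k) (n - 1)" for n
  \<comment> \<open>For \<open>k > 1\<close> there need not be a plateau before \<open>F\<close>, so \<open>c < E m\<close> must be kept strict;
      the plateau before \<open>E m\<close>, used once more under \<open>A\<^sup>k\<^sup>-\<^sup>1\<close>, makes this possible.\<close>
  define good where "good n \<longleftrightarrow> b n \<le> F \<and> n \<le> b n + E m \<and> (n < b n + E m \<or> k = 1)" for n
  have A_n: "A n \<le> E m \<and> n + 1 \<le> A n + F"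
    if n: "E m \<le> n" "n < E m + F" and "good n" for n
  proof -
    define c where "c = n - b n"
    have bn: "1 \<le> b n" "b n \<le> n - 1"
      using iter_bounds[of "n - 1" k] n \<open>3 \<le> E m\<close> unfolding b_def by auto
    have bc: "b n \<le> F" "c \<le> E m" "c < E m \<or> k = 1" "1 \<le> c" "n = b n + c"
      using \<open>good n\<close> bn n \<open>3 \<le> E m\<close> unfolding good_def c_def by auto
    have split: "A n = A (b n) + A c"
      using A_rec[of n] n \<open>3 \<le> E m\<close> unfolding c_def b_def by simp
    have A_b: "A (b n) \<le> E (m - k)" "E (m - k) \<le> A (b n) + (F - b n)"
      using A_slow[of "b n" F] bn bc F by simp_all
    have A_c: "A c \<le> E (m - 1)" using A_slow[of c "E m"] bc IH[of m] m k_pos by simp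
    show ?thesis
    proof (cases "c < E m")
      case True
      then have "E (m - 1) \<le> A c + (E m - 1 - c)"
        using A_slow[of c "E m - 1"] bc plateau by simp
      then show ?thesis using split A_b A_c bc(1,5) True E_m by linarith
    next
      case False
      \<comment> \<open>For \<open>k = 1\<close> both arguments are bounded by \<open>E m\<close>.
        They cannot both equal it, so the plateau now saves its unit at \<open>b n\<close>.\<close>
      then have "c = E m" "k = 1" using bc by auto
      then have "F = E m" unfolding F_def by simp
      then have "b n < E m" using bc(5) n \<open>c = E m\<close> by linarith
      then have "E (m - 1) \<le> A (b n) + (E m - 1 - b n)"
        using A_slow[of "b n" "E m - 1"] bn plateau by simp
      moreover have "A c = E (m - 1)" using IH[of m] m \<open>c = E m\<close> k_pos by simp
      moreover have "E (m - k) = E (m - 1)" using \<open>k = 1\<close> by simp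
      ultimately show ?thesis
        using split A_b bc(5) E_m \<open>F = E m\<close> \<open>b n < E m\<close> \<open>c = E m\<close> by linarith
    qed
  qed
  have good_Suc: "good (Suc n)" if n: "E m \<le> n" "Suc n < E m + F" and "good n" for n
  proof -
    have An: "A n \<le> E m" "n + 1 \<le> A n + F" using A_n[of n] that by auto
    have b: "b (Suc n) = (A ^^ (k - 1)) (A n)" unfolding b_def using iter_Suc by simp
    have An1: "1 \<le> A n" using A_bounds[of n] n \<open>3 \<le> E m\<close> by simp
    have lo: "b (Suc n) \<le> F" "F \<le> b (Suc n) + (E m - A n)"
      using iter_slow[OF An1 An(1), of "k - 1"] F b by auto
    consider "k = 1" | "A n = E m" | "k \<noteq> 1" "A n < E m" using An by linarith
    then show ?thesis
    proof cases
      case 1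
      then show ?thesis using lo An unfolding good_def by linarith
    next
      case 2
      then show ?thesis using lo n unfolding good_def by linarith
    next
      case 3
      then obtain l where l: "k - 1 = Suc l" using k_pos by (cases "k - 1") auto
      \<comment> \<open>Since \<open>k - 1\<close> is positive, its iterate also agrees at
        \<open>E m\<close> and \<open>E m - 1\<close>; comparing with the latter gains the unit
        needed for strictness.\<close>
      have "A (E m) = A (E m - 1)" using IH[of m] plateau m k_pos by simp
      then have "(A ^^ (k - 1)) (E m - 1) = F" using F(3) unfolding l funpow_Suc_right by simp
      then have "F \<le> b (Suc n) + (E m - 1 - A n)"
        using iter_slow[OF An1, of "E m - 1" "k - 1"] 3 b by simp
      then show ?thesis using lo An 3 unfolding good_def by linarith
    qed
  qed
  have good: "good n" if "E m \<le> n" "n < E m + F" for n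
    using that
  proof (induction n rule: dec_induct)
    case base
    have "1 \<le> b (E m)" using iter_bounds[of "E m - 1" k] \<open>3 \<le> E m\<close> unfolding b_def by simp
    moreover have "b (E m) \<le> F"
      using iter_slow[of "E m - 1" "E m" k] F(4) \<open>3 \<le> E m\<close> unfolding b_def by linarith
    ultimately show ?case unfolding good_def by simp
  next
    case (step n)
    then show ?case using good_Suc by simp
  qed
  \<comment> \<open>At this last index before \<open>E (m + 1)\<close> the two bounds of
    \<open>A_n\<close> coincide.\<close>
  define p where "p = E m + F - 1"
  have p: "E m \<le> p" "p < E m + F" "p + 1 = E m + F" using F(1) unfolding p_def by auto
  have A_p: "A p = E m" using A_n[OF p(1,2) good[OF p(1,2)]] p by simp
  then have "(A ^^ k) p = F" using iter_Suc F(3) by simp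
  then have "A (p + 1) = A F + A (E m)" using A_rec[of "p + 1"] p \<open>3 \<le> E m\<close> by simp
  then have "A (p + 1) = E m" using F(2) IH[of m] m k_pos E_m by simp
  then show ?thesis using A_p p E_Suc by (simp add: p_def)
qed

text \<open>The claim covers all smaller indices because the step follows the iterates of
  \<open>A\<close> from \<open>E m\<close> down to \<open>E (m - k)\<close>.\<close>

lemma A_E_large:
  assumes "2 * k + 1 \<le> m"
  shows "(\<forall>i. 2 \<le> i \<longrightarrow> i \<le> m \<longrightarrow> A (E i) = E (i - 1)) \<and> A (E m - 1) = E (m - 1)"
  using assms
proof (induction m rule: dec_induct)
  case base
  have "A (E i) = E (i - 1)" if "2 \<le> i" "i \<le> 2 * k + 1" for i
    using A_E_initial[of i] A_E_2k_1 that by (cases "i = 2 * k + 1") auto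
  then show ?case using A_E_2k_1 by simp
next
  case (step m)
  then have "A (E (m + 1)) = E m \<and> A (E (m + 1) - 1) = E m" by (intro A_E_step) auto
  then show ?case using step by (auto simp: le_Suc_eq)
qed

lemma A_E: "2 \<le> n \<Longrightarrow> A (E n) = E (n - 1)"
  using A_E_large[of "n + 2 * k + 1"] by simp

end

theorem theorem2p1:
  fixes k :: nat and A E :: "nat \<Rightarrow> nat"
  assumes "k \<ge> 1"
    and "A 1 = 1" and "A 2 = 1"
    and "\<forall>n\<ge>3. A n = A ((A ^^ k) (n - 1)) + A (n - (A ^^ k) (n - 1))"
    and "\<forall>n. 1 \<le> n \<and> n \<le> k \<longrightarrow> E n = 1"
    and "\<forall>n>k. E n = E (n - 1) + E (n - k)"
  shows "\<forall>n\<ge>2. A (E n) = E (n - 1)"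
proof -
  interpret conway_pair k A E
    using assms by unfold_locales auto
  show ?thesis using A_E by blast
qed

end
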